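(* Let $d\ge 1$ and let $G$ be a bridgeless connected graph with $d(G)=d$ and maximum edge girth $g^*(G)\in\{2,3\}$. Then there is an orientation $\overrightarrow{G}$ of $G$ such that $d(\overrightarrow{G})=d$ if $g^*(G)=2$, and $d(\overrightarrow{G})\le 3d$ if $g^*(G)=3$.
   Context: Graphs are finite, connected, without loops, but multiple (parallel) edges are allowed; two parallel edges form a cycle of length $2$. $d(G)$ is the diameter of $G$ (maximum over pairs of vertices of the length of a shortest path). A bridge is an edge whose deletion disconnects the graph; $G$ is bridgeless if it has none. For an edge $e$ of a bridgeless graph $G$, the edge girth $l_G(e)$ is the length of a shortest cycle containing $e$, and the maximum edge girth is $g^*(G)=\max\{l_G(e): e\in E(G)\}$. An orientation $\overrightarrow{G}$ assigns one direction to each edge; $\partial(u,v)$ is the length of a shortest directed path from $u$ to $v$, and $d(\overrightarrow{G})=\max_{u,v}\partial(u,v)$ (infinite if the orientation is not strongly connected). *)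

theory Defs
  imports "HOL-Library.Extended_Nat" "Graph_Theory.Arc_Walk"
begin

text \<open>
  Undirected multigraphs. Edges are abstract objects, so parallel edges are distinct edges with the
  same set of endpoints.
\<close>

record ('v, 'e) multigraph =
  mg_verts :: "'v set"
  mg_edges :: "'e set"
  mg_ends :: "'e \<Rightarrow> 'v set"

locale fin_loopfree_multigraph =
  fixes G :: "('v, 'e) multigraph"
  assumes finite_mg_verts: "finite (mg_verts G)"
    and finite_mg_edges: "finite (mg_edges G)"
    and mg_ends_in_verts: "e \<in> mg_edges G \<Longrightarrow> mg_ends G e \<subseteq> mg_verts G"
    and card_mg_ends: "e \<in> mg_edges G \<Longrightarrow> card (mg_ends G e) = 2"

text \<open>
  A path is given by its vertices \<open>vs = [v\<^sub>0, \<dots>, v\<^sub>k]\<close> and edges \<open>es = [e\<^sub>1, \<dots>, e\<^sub>k]\<close>; its length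
  is \<open>k\<close>. The trivial path (\<open>k = 0\<close>) is allowed.
\<close>

definition mg_path :: "('v, 'e) multigraph \<Rightarrow> 'v \<Rightarrow> 'v list \<Rightarrow> 'e list \<Rightarrow> 'v \<Rightarrow> bool" where
  "mg_path G u vs es v \<longleftrightarrow>
     length vs = Suc (length es) \<and> hd vs = u \<and> last vs = v \<and>
     set vs \<subseteq> mg_verts G \<and> set es \<subseteq> mg_edges G \<and> distinct vs \<and>
     (\<forall>i < length es. mg_ends G (es ! i) = {vs ! i, vs ! Suc i})"

definition mg_connected :: "('v, 'e) multigraph \<Rightarrow> bool" where
  "mg_connected G \<longleftrightarrow> mg_verts G \<noteq> {} \<and>
     (\<forall>u \<in> mg_verts G. \<forall>v \<in> mg_verts G. \<exists>vs es. mg_path G u vs es v)"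

definition mg_delete_edge :: "('v, 'e) multigraph \<Rightarrow> 'e \<Rightarrow> ('v, 'e) multigraph" where
  "mg_delete_edge G e = G\<lparr>mg_edges := mg_edges G - {e}\<rparr>"

definition mg_bridge :: "('v, 'e) multigraph \<Rightarrow> 'e \<Rightarrow> bool" where
  "mg_bridge G e \<longleftrightarrow> e \<in> mg_edges G \<and> \<not> mg_connected (mg_delete_edge G e)"

definition mg_bridgeless :: "('v, 'e) multigraph \<Rightarrow> bool" where
  "mg_bridgeless G \<longleftrightarrow> (\<nexists>e. mg_bridge G e)"

text \<open>Distances, diameters and girths are \<open>\<infinity>\<close> where no path or cycle exists.\<close>

definition mg_dist :: "('v, 'e) multigraph \<Rightarrow> 'v \<Rightarrow> 'v \<Rightarrow> enat" where
  "mg_dist G u v = (INF (vs, es) \<in> {(vs, es). mg_path G u vs es v}. enat (length es))"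

definition mg_diameter :: "('v, 'e) multigraph \<Rightarrow> enat" where
  "mg_diameter G = (SUP (u, v) \<in> mg_verts G \<times> mg_verts G. mg_dist G u v)"

text \<open>
  A cycle of length \<open>k \<ge> 2\<close> has \<open>k\<close> distinct vertices and \<open>k\<close> distinct edges. Distinctness of the
  edges matters only for \<open>k = 2\<close>, where it makes the cycles exactly the pairs of parallel edges.
\<close>

definition mg_cycle :: "('v, 'e) multigraph \<Rightarrow> 'v list \<Rightarrow> 'e list \<Rightarrow> bool" where
  "mg_cycle G vs es \<longleftrightarrow>
     length vs = length es \<and> 2 \<le> length es \<and>
     set vs \<subseteq> mg_verts G \<and> set es \<subseteq> mg_edges G \<and> distinct vs \<and> distinct es \<and>
     (\<forall>i < length es. mg_ends G (es ! i) = {vs ! i, vs ! (Suc i mod length es)})"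

definition edge_girth :: "('v, 'e) multigraph \<Rightarrow> 'e \<Rightarrow> enat" where
  "edge_girth G e = (INF (vs, es) \<in> {(vs, es). mg_cycle G vs es \<and> e \<in> set es}. enat (length es))"

definition max_edge_girth :: "('v, 'e) multigraph \<Rightarrow> enat" where
  "max_edge_girth G = (SUP e \<in> mg_edges G. edge_girth G e)"

definition orientation_of :: "('v, 'e) pre_digraph \<Rightarrow> ('v, 'e) multigraph \<Rightarrow> bool" where
  "orientation_of D G \<longleftrightarrow>
     verts D = mg_verts G \<and> arcs D = mg_edges G \<and>
     (\<forall>e \<in> mg_edges G. mg_ends G e = {tail D e, head D e})"

definition di_dist :: "('v, 'e) pre_digraph \<Rightarrow> 'v \<Rightarrow> 'v \<Rightarrow> enat" where
  "di_dist D u v = (INF p \<in> {p. pre_digraph.apath D u p v}. enat (length p))"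

definition di_diameter :: "('v, 'e) pre_digraph \<Rightarrow> enat" where
  "di_diameter D = (SUP (u, v) \<in> verts D \<times> verts D. di_dist D u v)"

end

theory Submission
  imports Defs
begin

text \<open>
  Choose an orientation with as many arcs as possible on directed cycles of length at most
  \<open>k = g\<^sup>*(G)\<close>. Redirecting arcs that lie on no such cycle preserves all the existing ones, so by
  maximality no redirection creates a new one. For \<open>k = 2\<close> this puts every arc on a directed digon.
  For \<open>k = 3\<close> take an arc \<open>u \<rightarrow> v\<close> on no short directed cycle, and a triangle \<open>u, v, w\<close>. Were the
  triangle's other two edges not both on short directed cycles, or were they consistently directed,
  we could redirect and gain an arc. Hence both lie on short directed cycles and both point to \<open>w\<close>
  or both away from it; replacing one of them by the at most two remaining arcs of its short cycle
  leads from \<open>v\<close> to \<open>u\<close> in at most three steps. In either case the ends of an edge are at directed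
  distance at most \<open>1\<close> respectively \<open>3\<close>, and this factor carries over to all distances.
\<close>

text \<open>Extracts an actual path or cycle from a finite bound on \<open>mg_dist\<close> or
  \<open>edge_girth\<close>. Otherwise \<open>Suc n\<close> would be a lower bound; this includes
  the case of empty \<open>A\<close>, whose infimum is infinite.\<close>

lemma INF_enat_leD:
  assumes "(INF x\<in>A. enat (f x)) \<le> enat n"
  shows "\<exists>x\<in>A. f x \<le> n"
proof (rule ccontr)
  assume "\<not> ?thesis"
  then have "enat (Suc n) \<le> (INF x\<in>A. enat (f x))"
    by (intro INF_greatest) (auto simp: not_le Suc_le_eq)
  with assms have "enat (Suc n) \<le> enat n" by (rule order_trans[rotated])
  then show False by simp
qed

section \<open>Directed distances\<close>

text \<open>Cutting out a closed subwalk at a repeated vertex strictly shortens the walk. Hence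
  walks may be concatenated freely below, although \<open>di_dist\<close> refers to paths.\<close>

lemma (in wf_digraph) awalk_imp_shorter_apath:
  assumes "awalk u p v"
  shows "\<exists>q. apath u q v \<and> length q \<le> length p"
  using assms
proof (induction "length p" arbitrary: p rule: less_induct)
  case less
  show ?case
  proof (cases "distinct (awalk_verts u p)")
    case True
    with less.prems show ?thesis by (auto simp: apath_def)
  next
    case False
    from awalk_not_distinct_decomp[OF less.prems this] obtain q r s w
      where p: "p = q @ r @ s" "r \<noteq> []" "awalk u q w" "awalk w s v"
      by blast
    from p(3,4) have "awalk u (q @ s) v" by (rule awalk_appendI)
    with less.hyps[of "q @ s"] p(1,2) show ?thesis by fastforce
  qed
qed

lemma (in wf_digraph) di_dist_le_awalk:
  assumes "awalk u p v" "length p \<le> n"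
  shows "di_dist G u v \<le> enat n"
proof -
  obtain q where "apath u q v" "length q \<le> length p"
    using awalk_imp_shorter_apath[OF assms(1)] by blast
  then have "di_dist G u v \<le> enat (length q)"
    unfolding di_dist_def by (intro INF_lower) simp
  also have "\<dots> \<le> enat n" using \<open>length q \<le> length p\<close> assms(2) by simp
  finally show ?thesis .
qed

lemma awalk_cong:
  assumes "pre_digraph.awalk D u p v" "verts D' = verts D" "arcs D' = arcs D"
    and "\<And>e. e \<in> set p \<Longrightarrow> tail D' e = tail D e \<and> head D' e = head D e"
  shows "pre_digraph.awalk D' u p v"
proof -
  have "pre_digraph.cas D u p v \<Longrightarrow> pre_digraph.cas D' u p v"
    using assms(4) by (induction p arbitrary: u) (auto simp: pre_digraph.cas.simps)
  with assms show ?thesis by (simp add: pre_digraph.awalk_def)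
qed

section \<open>From a bound for single edges to a bound on the directed diameter\<close>

lemma orientation_of_wf_digraph:
  assumes "fin_loopfree_multigraph G" "orientation_of D G"
  shows "wf_digraph D"
proof
  interpret fin_loopfree_multigraph G by fact
  fix e assume "e \<in> arcs D"
  with assms(2) mg_ends_in_verts[of e] show "tail D e \<in> verts D" "head D e \<in> verts D"
    by (auto simp: orientation_of_def)
qed

lemma mg_path_Cons:
  assumes "mg_path G u vs (e # es) v"
  obtains w ws where "mg_path G w ws es v" "e \<in> mg_edges G" "mg_ends G e = {u, w}"
proof -
  obtain w ws where vs: "vs = u # w # ws"
    using assms by (cases vs; cases "tl vs") (auto simp: mg_path_def)
  show thesis
  proof
    have *: "\<forall>i<Suc (length es). mg_ends G ((e # es) ! i) = {vs ! i, vs ! Suc i}"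
      using assms by (simp add: mg_path_def)
    have "mg_ends G (es ! i) = {(w # ws) ! i, (w # ws) ! Suc i}" if "i < length es" for i
      using *[rule_format, of "Suc i"] that unfolding vs by simp
    then show "mg_path G w (w # ws) es v"
      using assms unfolding vs mg_path_def by auto
    show "e \<in> mg_edges G" "mg_ends G e = {u, w}"
      using assms *[rule_format, of 0] unfolding vs mg_path_def by auto
  qed
qed

text \<open>Each edge of the path is replaced by a walk of length at most \<open>c\<close>. As
  \<open>{x, y}\<close> is unordered, \<open>step\<close> covers both ways of traversing an
  edge.\<close>

lemma awalk_along_mg_path:
  assumes "fin_loopfree_multigraph G" "orientation_of D G"
    and step: "\<And>e x y. e \<in> mg_edges G \<Longrightarrow> mg_ends G e = {x, y} \<Longrightarrow>
      \<exists>p. pre_digraph.awalk D x p y \<and> length p \<le> c"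
    and "mg_path G u vs es v"
  shows "\<exists>p. pre_digraph.awalk D u p v \<and> length p \<le> c * length es"
  using assms(4)
proof (induction es arbitrary: u vs)
  interpret wf_digraph D using assms(1,2) by (rule orientation_of_wf_digraph)
  case Nil
  then have "u = v" "u \<in> verts D"
    using assms(2) by (auto simp: mg_path_def orientation_of_def length_Suc_conv)
  then show ?case by (intro exI[of _ "[]"]) (simp add: awalk_Nil_iff)
next
  interpret wf_digraph D using assms(1,2) by (rule orientation_of_wf_digraph)
  case (Cons e es)
  obtain w ws where w: "mg_path G w ws es v" "e \<in> mg_edges G" "mg_ends G e = {u, w}"
    using mg_path_Cons[OF Cons.prems] .
  obtain p where p: "awalk u p w" "length p \<le> c" using step[OF w(2,3)] by blast
  obtain q where q: "awalk w q v" "length q \<le> c * length es" using Cons.IH[OF w(1)] by blast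
  from p q show ?case by (intro exI[of _ "p @ q"]) (auto intro: awalk_appendI)
qed

lemma di_diameter_le_if_edge_bound:
  assumes "fin_loopfree_multigraph G" "orientation_of D G" "mg_diameter G = enat d"
    and step: "\<And>e x y. e \<in> mg_edges G \<Longrightarrow> mg_ends G e = {x, y} \<Longrightarrow>
      \<exists>p. pre_digraph.awalk D x p y \<and> length p \<le> c"
  shows "di_diameter D \<le> enat (c * d)"
  unfolding di_diameter_def
proof (rule SUP_least, clarify)
  interpret wf_digraph D using assms(1,2) by (rule orientation_of_wf_digraph)
  fix u v assume "u \<in> verts D" "v \<in> verts D"
  then have "(u, v) \<in> mg_verts G \<times> mg_verts G" using assms(2) by (simp add: orientation_of_def)
  then have "mg_dist G u v \<le> enat d"
    unfolding assms(3)[symmetric] mg_diameter_def by (intro SUP_upper2[of "(u, v)"]) auto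
  then obtain vs es where es: "mg_path G u vs es v" "length es \<le> d"
    using INF_enat_leD[of "\<lambda>(vs, es). length es" "{(vs, es). mg_path G u vs es v}" d]
    by (auto simp: mg_dist_def case_prod_unfold)
  obtain p where "awalk u p v" "length p \<le> c * length es"
    using awalk_along_mg_path[OF assms(1,2) _ es(1), of c] step by blast
  moreover from this(2) have "length p \<le> c * d" using es(2) by (meson mult_le_mono2 order_trans)
  ultimately show "di_dist D u v \<le> enat (c * d)" by (blast intro: di_dist_le_awalk)
qed

text \<open>Forgetting directions cannot increase distances; this is what yields the lower bound on
  the directed diameter.\<close>

lemma apath_imp_mg_path:
  assumes "wf_digraph D" "orientation_of D G" "pre_digraph.apath D u p v"
  shows "mg_path G u (pre_digraph.awalk_verts D u p) p v"
proof -
  interpret wf_digraph D by fact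
  have aw: "awalk u p v" and dist: "distinct (awalk_verts u p)"
    using assms(3) by (auto simp: apath_def)
  have "\<forall>i<length p. mg_ends G (p ! i) = {awalk_verts u p ! i, awalk_verts u p ! Suc i}"
    using aw
  proof (induction p arbitrary: u)
    case (Cons e p)
    then have e: "e \<in> arcs D" "awalk (head D e) p v" by (auto simp: awalk_Cons_iff)
    have "awalk_verts (head D e) p ! 0 = head D e"
      using e(2) by (cases p) (auto simp: awalk_Cons_iff)
    with e assms(2) Cons.IH[OF e(2)] show ?case
      by (auto simp: less_Suc_eq_0_disj orientation_of_def)
  qed simp
  moreover have "set (awalk_verts u p) \<subseteq> verts D" "set p \<subseteq> arcs D"
    "hd (awalk_verts u p) = u" "last (awalk_verts u p) = v"
    using aw by auto
  ultimately show ?thesis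
    using dist assms(2) by (simp add: mg_path_def length_awalk_verts orientation_of_def)
qed

lemma mg_diameter_le_di_diameter:
  assumes "wf_digraph D" "orientation_of D G"
  shows "mg_diameter G \<le> di_diameter D"
  unfolding mg_diameter_def
proof (rule SUP_least, clarify)
  fix u v assume "u \<in> mg_verts G" "v \<in> mg_verts G"
  then have uv: "(u, v) \<in> verts D \<times> verts D" using assms(2) by (simp add: orientation_of_def)
  have "mg_dist G u v \<le> di_dist D u v"
    unfolding di_dist_def
  proof (rule INF_greatest)
    fix p assume "p \<in> {p. pre_digraph.apath D u p v}"
    then show "mg_dist G u v \<le> enat (length p)"
      unfolding mg_dist_def using apath_imp_mg_path[OF assms, of u p v]
      by (intro INF_lower2[of "(pre_digraph.awalk_verts D u p, p)"]) auto
  qed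
  also have "\<dots> \<le> di_diameter D"
    unfolding di_diameter_def using uv by (intro SUP_upper2[of "(u, v)"]) auto
  finally show "mg_dist G u v \<le> di_diameter D" .
qed

section \<open>Edges of small girth\<close>

lemma edge_girth_leD:
  assumes "edge_girth G e \<le> enat k"
  obtains vs es where "mg_cycle G vs es" "e \<in> set es" "length es \<le> k"
  using INF_enat_leD[of "\<lambda>(vs, es). length es" "{(vs, es). mg_cycle G vs es \<and> e \<in> set es}" k] assms
  by (auto simp: edge_girth_def case_prod_unfold)

lemma mg_cycle_length_2:
  assumes "mg_cycle G vs es" "e \<in> set es" "length es = 2"
  shows "\<exists>f\<in>mg_edges G. f \<noteq> e \<and> mg_ends G f = mg_ends G e"
proof -
  obtain a b where es: "es = [a, b]"
    using assms(3) by (auto simp: numeral_eq_Suc length_Suc_conv)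
  have "length vs = 2" using assms(1,3) by (simp add: mg_cycle_def)
  then obtain x y where vs: "vs = [x, y]"
    by (auto simp: numeral_eq_Suc length_Suc_conv)
  have ends: "\<And>i. i < 2 \<Longrightarrow> mg_ends G (es ! i) = {vs ! i, vs ! (Suc i mod 2)}"
    using assms(1,3) by (simp add: mg_cycle_def)
  have "mg_ends G a = {x, y}" "mg_ends G b = {y, x}"
    using ends[of 0] ends[of 1] by (simp_all add: es vs)
  moreover have "a \<noteq> b" "a \<in> mg_edges G" "b \<in> mg_edges G"
    using assms(1) unfolding es mg_cycle_def by simp_all
  ultimately show ?thesis using assms(2) es by (auto simp: insert_commute)
qed

lemma mg_cycle_length_3:
  assumes "mg_cycle G vs es" "e \<in> set es" "length es = 3"
  obtains f g x y z where "f \<in> mg_edges G" "g \<in> mg_edges G" "distinct [x, y, z]"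
    "mg_ends G e = {x, y}" "mg_ends G f = {y, z}" "mg_ends G g = {z, x}"
proof -
  obtain a b c where es: "es = [a, b, c]"
    using assms(3) by (auto simp: numeral_eq_Suc length_Suc_conv)
  have "length vs = 3" using assms(1,3) by (simp add: mg_cycle_def)
  then obtain x y z where vs: "vs = [x, y, z]"
    by (auto simp: numeral_eq_Suc length_Suc_conv)
  have ends: "\<And>i. i < 3 \<Longrightarrow> mg_ends G (es ! i) = {vs ! i, vs ! (Suc i mod 3)}"
    using assms(1,3) by (simp add: mg_cycle_def)
  have *: "mg_ends G a = {x, y}" "mg_ends G b = {y, z}" "mg_ends G c = {z, x}"
    using ends[of 0] ends[of 1] ends[of 2] by (simp_all add: es vs)
  have **: "a \<in> mg_edges G" "b \<in> mg_edges G" "c \<in> mg_edges G"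
    using assms(1) unfolding es mg_cycle_def by simp_all
  have d: "distinct [x, y, z]"
    using assms(1) unfolding vs mg_cycle_def by simp
  \<comment> \<open>Rotating the triangle brings \<open>e\<close> to the front.\<close>
  from assms(2) es consider "e = a" | "e = b" | "e = c" by auto
  then show thesis
  proof cases
    case 1
    then show thesis using that[of b c x y z] * ** d by simp
  next
    case 2
    then show thesis using that[of c a y z x] * ** d by auto
  next
    case 3
    then show thesis using that[of a b z x y] * ** d by auto
  qed
qed

section \<open>Orientations with the most arcs on short directed cycles\<close>

text \<open>Closed walks stand in for directed cycles, so no distinctness has to be checked. Nothing
  changes: an arc of a closed walk also lies on a directed cycle that is no longer than the
  walk.\<close>

definition short_cycle_arcs :: "nat \<Rightarrow> ('v, 'e) pre_digraph \<Rightarrow> 'e set" where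
  "short_cycle_arcs k D = {e. \<exists>u p. pre_digraph.awalk D u p u \<and> e \<in> set p \<and> length p \<le> k}"

definition best_orientation :: "nat \<Rightarrow> ('v, 'e) pre_digraph \<Rightarrow> ('v, 'e) multigraph \<Rightarrow> bool" where
  "best_orientation k D G \<longleftrightarrow> orientation_of D G \<and>
     (\<forall>D'. orientation_of D' G \<longrightarrow> card (short_cycle_arcs k D') \<le> card (short_cycle_arcs k D))"

lemma short_cycle_arcs_subset: "short_cycle_arcs k D \<subseteq> arcs D"
  by (auto simp: short_cycle_arcs_def pre_digraph.awalk_def)

text \<open>Start the closed walk right after an occurrence of \<open>e\<close> and leave out that
  occurrence.\<close>

lemma short_cycle_arcs_return:
  assumes "wf_digraph D" "e \<in> short_cycle_arcs k D"
  shows "\<exists>p. pre_digraph.awalk D (head D e) p (tail D e) \<and> Suc (length p) \<le> k"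
proof -
  interpret wf_digraph D by fact
  obtain u p where "awalk u p u" "e \<in> set p" "length p \<le> k"
    using assms(2) by (auto simp: short_cycle_arcs_def)
  moreover from this obtain p1 p2 where p: "p = p1 @ e # p2" by (meson split_list)
  ultimately have "awalk u p1 (tail D e)" "awalk (head D e) p2 u"
    by (auto simp: awalk_Cons_iff)
  then have "awalk (head D e) (p2 @ p1) (tail D e)" by (rule awalk_appendI[rotated])
  with p \<open>length p \<le> k\<close> show ?thesis by (intro exI[of _ "p2 @ p1"]) auto
qed

context fin_loopfree_multigraph
begin

lemma ex_orientation: "\<exists>D. orientation_of D G"
proof -
  have "\<exists>x y. mg_ends G e = {x, y}" if "e \<in> mg_edges G" for e
    using card_mg_ends[OF that] by (auto simp: card_2_iff)
  then obtain t h where "\<And>e. e \<in> mg_edges G \<Longrightarrow> mg_ends G e = {t e, h e}" by metis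
  then have "orientation_of \<lparr>verts = mg_verts G, arcs = mg_edges G, tail = t, head = h\<rparr> G"
    by (simp add: orientation_of_def)
  then show ?thesis ..
qed

text \<open>The quantity to be maximised never exceeds the number of edges.\<close>

lemma ex_best_orientation: "\<exists>D. best_orientation k D G"
proof -
  obtain D where "orientation_of D G" using ex_orientation by blast
  moreover have "\<forall>D. orientation_of D G \<longrightarrow>
      card (short_cycle_arcs k D) < Suc (card (mg_edges G))"
    using card_mono[OF finite_mg_edges] short_cycle_arcs_subset
    by (metis le_imp_less_Suc orientation_of_def)
  ultimately show ?thesis
    using ex_has_greatest_nat[of "\<lambda>D. orientation_of D G" D "\<lambda>D. card (short_cycle_arcs k D)"]
    unfolding best_orientation_def by blast
qed

section \<open>Redirecting arcs of a best orientation\<close>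

text \<open>Short closed walks of \<open>D\<close> survive in \<open>D'\<close>, which gives one
  inclusion; maximality of \<open>D\<close> and finiteness turn it into equality.\<close>

lemma best_orientation_redirect:
  assumes best: "best_orientation k D G" and D': "orientation_of D' G"
    and agree: "\<And>e. e \<in> short_cycle_arcs k D \<Longrightarrow> tail D' e = tail D e \<and> head D' e = head D e"
  shows "short_cycle_arcs k D' = short_cycle_arcs k D"
proof -
  have D: "orientation_of D G" using best by (simp add: best_orientation_def)
  have "short_cycle_arcs k D \<subseteq> short_cycle_arcs k D'"
  proof
    fix e assume "e \<in> short_cycle_arcs k D"
    then obtain u p where p: "pre_digraph.awalk D u p u" "e \<in> set p" "length p \<le> k"
      by (auto simp: short_cycle_arcs_def)
    \<comment> \<open>All arcs of a short closed walk belong to the set along with \<open>e\<close>,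
      so \<open>D'\<close> agrees with \<open>D\<close> on the whole walk.\<close>
    then have "set p \<subseteq> short_cycle_arcs k D" by (auto simp: short_cycle_arcs_def)
    then have "pre_digraph.awalk D' u p u"
      using D D' agree by (intro awalk_cong[OF p(1)]) (auto simp: orientation_of_def)
    with p(2,3) show "e \<in> short_cycle_arcs k D'" by (auto simp: short_cycle_arcs_def)
  qed
  moreover have "finite (short_cycle_arcs k D')"
    using D' finite_mg_edges short_cycle_arcs_subset[of k D']
    by (auto simp: orientation_of_def intro: finite_subset)
  moreover have "card (short_cycle_arcs k D') \<le> card (short_cycle_arcs k D)"
    using best D' by (simp add: best_orientation_def)
  ultimately show ?thesis by (metis card_seteq)
qed

lemma best_orientation_digon:
  assumes best: "best_orientation k D G" and "2 \<le> k"
    and e: "e \<in> mg_edges G" and f: "f \<in> mg_edges G" "f \<noteq> e" "mg_ends G f = mg_ends G e"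
  shows "e \<in> short_cycle_arcs k D"
proof (rule ccontr)
  assume ne: "e \<notin> short_cycle_arcs k D"
  \<comment> \<open>Only \<open>e\<close> is redirected, against whatever direction \<open>f\<close>
    has, so that \<open>[f, e]\<close> becomes a directed digon.\<close>
  define D' where "D' = D\<lparr>tail := (tail D)(e := head D f), head := (head D)(e := tail D f)\<rparr>"
  have D: "orientation_of D G" using best by (simp add: best_orientation_def)
  then have D': "orientation_of D' G"
    using e f by (auto simp: orientation_of_def D'_def)
  have eq: "short_cycle_arcs k D' = short_cycle_arcs k D"
    using best D' by (rule best_orientation_redirect) (use ne in \<open>auto simp: D'_def\<close>)
  interpret D': wf_digraph D'
    using fin_loopfree_multigraph_axioms D' by (rule orientation_of_wf_digraph)
  have arcs: "e \<in> arcs D'" "f \<in> arcs D'" using e f D' by (auto simp: orientation_of_def)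
  moreover from arcs have "tail D' f \<in> verts D'" by simp
  ultimately have "D'.awalk (tail D f) [f, e] (tail D f)"
    using f(2) by (simp add: D'.awalk_simps) (simp add: D'_def)
  then have "e \<in> short_cycle_arcs k D'"
    using \<open>2 \<le> k\<close> by (auto simp: short_cycle_arcs_def intro!: exI[of _ "tail D f"] exI[of _ "[f, e]"])
  with ne eq show False by simp
qed

text \<open>The hypotheses \<open>cyc\<close> say that the triangle's arcs on short directed cycles
  already follow u, v, w, u. The remaining ones are free to be redirected, and doing so closes the
  triangle into a directed cycle.\<close>

lemma best_orientation_triangle:
  assumes best: "best_orientation k D G" and "3 \<le> k" and d: "distinct [u, v, w]"
    and edges: "e \<in> mg_edges G" "f \<in> mg_edges G" "g \<in> mg_edges G"
    and ends: "mg_ends G e = {u, v}" "mg_ends G f = {v, w}" "mg_ends G g = {w, u}"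
    and cyc: "e \<in> short_cycle_arcs k D \<Longrightarrow> tail D e = u"
      "f \<in> short_cycle_arcs k D \<Longrightarrow> tail D f = v"
      "g \<in> short_cycle_arcs k D \<Longrightarrow> tail D g = w"
  shows "e \<in> short_cycle_arcs k D"
proof -
  define D' where "D' = D\<lparr>tail := (tail D)(e := u, f := v, g := w),
    head := (head D)(e := v, f := w, g := u)\<rparr>"
  have D: "orientation_of D G" using best by (simp add: best_orientation_def)
  have dist: "e \<noteq> f" "f \<noteq> g" "e \<noteq> g" using d ends by (auto simp: doubleton_eq_iff)
  have D': "orientation_of D' G"
    using D ends dist by (auto simp: orientation_of_def D'_def)
  have "{tail D e, head D e} = {u, v}" "{tail D f, head D f} = {v, w}"
    "{tail D g, head D g} = {w, u}"
    using D edges ends by (auto simp: orientation_of_def)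
  then have heads: "tail D e = u \<Longrightarrow> head D e = v" "tail D f = v \<Longrightarrow> head D f = w"
    "tail D g = w \<Longrightarrow> head D g = u"
    by (auto simp: doubleton_eq_iff)
  have eq: "short_cycle_arcs k D' = short_cycle_arcs k D"
    using best D'
  proof (rule best_orientation_redirect)
    fix x assume "x \<in> short_cycle_arcs k D"
    then show "tail D' x = tail D x \<and> head D' x = head D x"
      using cyc heads dist by (auto simp: D'_def)
  qed
  interpret D': wf_digraph D'
    using fin_loopfree_multigraph_axioms D' by (rule orientation_of_wf_digraph)
  have arcs: "e \<in> arcs D'" "f \<in> arcs D'" "g \<in> arcs D'"
    using edges D' by (auto simp: orientation_of_def)
  moreover from arcs have "tail D' e \<in> verts D'" by simp
  ultimately have "D'.awalk u [e, f, g] u"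
    using dist by (simp add: D'.awalk_simps) (simp add: D'_def)
  then have "e \<in> short_cycle_arcs k D'"
    using \<open>3 \<le> k\<close> by (auto simp: short_cycle_arcs_def intro!: exI[of _ u] exI[of _ "[e, f, g]"])
  with eq show ?thesis by simp
qed

lemma best_orientation_triangle_return:
  assumes best: "best_orientation 3 D G" and d: "distinct [u, v, w]"
    and edges: "e \<in> mg_edges G" "f \<in> mg_edges G" "g \<in> mg_edges G"
    and ends: "mg_ends G e = {u, v}" "mg_ends G f = {v, w}" "mg_ends G g = {w, u}"
    and tail: "tail D e = u"
  shows "\<exists>p. pre_digraph.awalk D v p u \<and> length p \<le> 3"
proof -
  let ?S = "short_cycle_arcs 3 D"
  have D: "orientation_of D G" using best by (simp add: best_orientation_def)
  interpret D: wf_digraph D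
    using fin_loopfree_multigraph_axioms D by (rule orientation_of_wf_digraph)
  have De: "{tail D e, head D e} = {u, v}" "{tail D f, head D f} = {v, w}"
    "{tail D g, head D g} = {w, u}" and arcs: "f \<in> arcs D" "g \<in> arcs D"
    using D edges ends by (auto simp: orientation_of_def)
  have ret: "\<exists>p. D.awalk (head D x) p (tail D x) \<and> length p \<le> 2" if "x \<in> ?S" for x
    using short_cycle_arcs_return[OF D.wf_digraph_axioms that] by auto
  show ?thesis
  proof (cases "e \<in> ?S")
    case True
    from ret[OF this] show ?thesis using De(1) tail d by (auto simp: doubleton_eq_iff)
  next
    case False
    \<comment> \<open>As \<open>e\<close> is not in \<open>?S\<close>, neither cyclic direction of
      the triangle can satisfy \<open>cyc\<close>: each is blocked by \<open>f\<close> or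
      \<open>g\<close>. First the direction u, v, w, then v, u, w.\<close>
    have "(f \<in> ?S \<and> tail D f \<noteq> v) \<or> (g \<in> ?S \<and> tail D g \<noteq> w)"
      using best_orientation_triangle[OF best _ d edges ends] False by auto
    moreover have "(g \<in> ?S \<and> tail D g \<noteq> u) \<or> (f \<in> ?S \<and> tail D f \<noteq> w)"
      using best_orientation_triangle[OF best _ _ edges(1,3,2), of v u w] False d ends
      by (auto simp: insert_commute)
    \<comment> \<open>One edge cannot block both directions, so \<open>f\<close> and
      \<open>g\<close> block one each and both point away from \<open>w\<close> or both towards it.
      Each case keeps the membership in \<open>?S\<close> only for the edge to be passed
      backwards.\<close>
    ultimately consider
        "f \<in> ?S" "tail D f = w" "head D f = v" "tail D g = w" "head D g = u"
      | "g \<in> ?S" "tail D g = u" "head D g = w" "tail D f = v" "head D f = w"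
      using De(2,3) d by (auto simp: doubleton_eq_iff)
    then show ?thesis
    proof cases
      case 1
      then obtain p where "D.awalk v p w" "length p \<le> 2" using ret[of f] by auto
      moreover have "D.awalk w [g] u" using D.arc_implies_awalk[OF arcs(2)] 1 by simp
      ultimately show ?thesis by (intro exI[of _ "p @ [g]"]) (auto intro: D.awalk_appendI)
    next
      case 2
      then obtain p where "D.awalk w p u" "length p \<le> 2" using ret[of g] by auto
      moreover have "D.awalk v [f] w" using D.arc_implies_awalk[OF arcs(1)] 2 by simp
      ultimately show ?thesis
        using D.awalk_appendI[of v "[f]" w p u] by (intro exI[of _ "[f] @ p"]) simp
    qed
  qed
qed

section \<open>The diameter of a best orientation\<close>

text \<open>A shortest cycle through \<open>e\<close> is a digon or a triangle. A digon puts
  \<open>e\<close> on a closed walk of length at most \<open>k\<close>, leaving at most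
  \<open>k - 1\<close> arcs for the way back: one if \<open>k = 2\<close>, two if
  \<open>k = 3\<close>.\<close>

lemma best_orientation_return:
  assumes best: "best_orientation k D G" and e: "e \<in> mg_edges G"
    and k: "k = 2 \<or> k = 3" and girth: "edge_girth G e \<le> enat k"
  shows "\<exists>p. pre_digraph.awalk D (head D e) p (tail D e) \<and> length p \<le> (if k = 2 then 1 else 3)"
proof -
  have D: "orientation_of D G" using best by (simp add: best_orientation_def)
  have wf: "wf_digraph D"
    using fin_loopfree_multigraph_axioms D by (rule orientation_of_wf_digraph)
  have De: "mg_ends G e = {tail D e, head D e}" using D e by (simp add: orientation_of_def)
  obtain vs es where es: "mg_cycle G vs es" "e \<in> set es" "length es \<le> k"
    using edge_girth_leD[OF girth] .
  then have "2 \<le> length es" by (simp add: mg_cycle_def)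
  with es(3) k consider "length es = 2" | "length es = 3" "k = 3" by linarith
  then show ?thesis
  proof cases
    case 1
    obtain f where "f \<in> mg_edges G" "f \<noteq> e" "mg_ends G f = mg_ends G e"
      using mg_cycle_length_2[OF es(1,2) 1] by blast
    then have "e \<in> short_cycle_arcs k D"
      using best_orientation_digon[OF best _ e] k by auto
    from short_cycle_arcs_return[OF wf this] show ?thesis using k by auto
  next
    case 2
    obtain f g x y z where fg: "f \<in> mg_edges G" "g \<in> mg_edges G" and d: "distinct [x, y, z]"
      and ends: "mg_ends G e = {x, y}" "mg_ends G f = {y, z}" "mg_ends G g = {z, x}"
      using mg_cycle_length_3[OF es(1,2) 2(1)] .
    have best3: "best_orientation 3 D G" using best 2 by simp
    have "\<exists>p. pre_digraph.awalk D (head D e) p (tail D e) \<and> length p \<le> 3"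
    proof (cases "tail D e = x")
      case True
      then have "head D e = y" using De[unfolded ends(1)] by (metis doubleton_eq_iff)
      then show ?thesis
        using best_orientation_triangle_return[OF best3 d e fg ends True] True by simp
    next
      case False
      then have h: "tail D e = y" "head D e = x"
        using De[unfolded ends(1)] by (metis doubleton_eq_iff)+
      \<comment> \<open>Here \<open>e\<close> runs from \<open>y\<close> to \<open>x\<close>, so the
        triangle is read in the opposite direction, with \<open>f\<close> and \<open>g\<close>
        exchanged.\<close>
      have "distinct [y, x, z]" using d by auto
      then show ?thesis
        using best_orientation_triangle_return[OF best3 _ e fg(2,1), of y x z] h ends
        by (metis insert_commute)
    qed
    with 2 show ?thesis by simp
  qed
qed

lemma best_orientation_di_diameter:
  assumes best: "best_orientation k D G" and k: "k = 2 \<or> k = 3"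
    and girth: "max_edge_girth G \<le> enat k" and diam: "mg_diameter G = enat d"
  shows "di_diameter D \<le> enat ((if k = 2 then 1 else 3) * d)"
proof (rule di_diameter_le_if_edge_bound[OF fin_loopfree_multigraph_axioms _ diam])
  show D: "orientation_of D G" using best by (simp add: best_orientation_def)
  interpret D: wf_digraph D
    using fin_loopfree_multigraph_axioms D by (rule orientation_of_wf_digraph)
  fix e x y assume e: "e \<in> mg_edges G" "mg_ends G e = {x, y}"
  have "edge_girth G e \<le> enat k"
    using SUP_upper[OF e(1), of "edge_girth G"] girth by (auto simp: max_edge_girth_def)
  note return = best_orientation_return[OF best e(1) k this]
  have "e \<in> arcs D" "{tail D e, head D e} = {x, y}" using D e by (auto simp: orientation_of_def)
  \<comment> \<open>Passing an edge forwards takes one arc, passing it backwards takes the return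
    walk.\<close>
  then consider "x = tail D e" "y = head D e" | "x = head D e" "y = tail D e"
    by (auto simp: doubleton_eq_iff)
  then show "\<exists>p. D.awalk x p y \<and> length p \<le> (if k = 2 then 1 else 3)"
  proof cases
    case 1
    then show ?thesis
      using D.arc_implies_awalk[OF \<open>e \<in> arcs D\<close>] by (intro exI[of _ "[e]"]) auto
  next
    case 2
    then show ?thesis using return by simp
  qed
qed

end

theorem theorem1p2:
  fixes G :: "('v, 'e) multigraph" and d :: nat
  assumes "fin_loopfree_multigraph G"
    and "mg_connected G"
    and "mg_bridgeless G"
    and "d \<ge> 1"
    and "mg_diameter G = enat d"
    and "max_edge_girth G \<in> {2, 3}"
  shows "\<exists>D. orientation_of D G \<and>
    (max_edge_girth G = 2 \<longrightarrow> di_diameter D = enat d) \<and>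
    (max_edge_girth G = 3 \<longrightarrow> di_diameter D \<le> enat (3 * d))"
proof -
  interpret fin_loopfree_multigraph G by fact
  obtain k :: nat where k: "k = 2 \<or> k = 3" "max_edge_girth G = enat k"
    using assms(6) by (auto simp: numeral_eq_enat)
  obtain D where best: "best_orientation k D G" using ex_best_orientation by blast
  then have D: "orientation_of D G" by (simp add: best_orientation_def)
  have upper: "di_diameter D \<le> enat ((if k = 2 then 1 else 3) * d)"
    using best_orientation_di_diameter[OF best k(1)] k(2) assms(5) by simp
  \<comment> \<open>For \<open>k = 2\<close> the factor in \<open>upper\<close> is 1, so the two
    bounds meet.\<close>
  have lower: "enat d \<le> di_diameter D"
    using mg_diameter_le_di_diameter[OF orientation_of_wf_digraph[OF assms(1) D] D] assms(5) by simp
  show ?thesis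
    using k D upper lower by (intro exI[of _ D]) (auto simp: numeral_eq_enat)
qed

end
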